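(* Let $g:\mathcal{X}\to\mathbb{R}^d$ be a differentiable map on a state space $\mathcal{X}\subseteq\mathbb{R}^n$, let $\omega_1,\dots,\omega_M\in\mathbb{R}^d$ be target samples with extent $e>0$, and let $h>0$. Let $\hat\omega_i=\omega_i/e$ and $\hat g(x)=g(x)/e$ be the normalized samples and normalized map, and let $\tilde{\mathcal{E}}_h$ be the associated log-surrogate objective, regarded as a function of the trajectory $x=(x_0,\dots,x_{T-1})\in\mathcal{X}^T$. Then $\tilde{\mathcal{E}}_h$ and its gradients are invariant under uniform rescaling of the physical domain. That is, for every $s>0$, if the physical domain is rescaled by $\omega\mapsto s\,\omega$ (so that $g$ is replaced by $s\,g$, each $\omega_i$ by $s\,\omega_i$, and $e$ by the extent of the rescaled samples), while $h$ is kept unchanged, then for every trajectory $x$ the value $\tilde{\mathcal{E}}_h$, the gradients $\partial_{\hat\omega^x_t}\tilde{\mathcal{E}}_h$ with respect to the normalized visited points, and the gradients $\partial_{x_t}\tilde{\mathcal{E}}_h$ with respect to the trajectory states are all unchanged.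
   Context: A trajectory is $x=(x_0,\dots,x_{T-1})\in\mathcal{X}^T$ and its visited points in physical units are $\omega^x_t=g(x_t)\in\mathbb{R}^d$. The environment extent of the samples is $e=\max_{\ell\in\{1,\dots,d\}}\big(\max_i[\omega_i]_\ell-\min_i[\omega_i]_\ell\big)$, assumed positive. Normalized coordinates are $\hat\omega=\omega/e$, so $\hat\omega_i=\omega_i/e$ and $\hat\omega^x_t=\hat g(x_t)=g(x_t)/e$. The kernel on normalized coordinates is $k_h(\hat u,\hat v)=\exp(-\|\hat u-\hat v\|_2^2/h)$, with bandwidth $h>0$. The log-surrogate objective is $$\tilde{\mathcal{E}}_h=\log\sum_{t,t'=0}^{T-1}k_h(\hat\omega^x_t,\hat\omega^x_{t'})-2\log\sum_{t=0}^{T-1}\sum_{i=1}^{M}k_h(\hat\omega^x_t,\hat\omega_i).$$ *)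

theory Defs
  imports "HOL-Analysis.Analysis"
begin

text \<open>
  Samples are indexed by \<open>1, \<dots>, M\<close> and time by \<open>0, \<dots>, T - 1\<close>; the values of the functions
  representing samples, points and trajectories at other indices are irrelevant. Since \<^const>\<open>Max\<close>
  and \<^const>\<open>Min\<close> are unspecified on the empty set, \<open>extent M \<omega>\<close> is meaningful only for \<open>M \<ge> 1\<close>.
\<close>

definition extent :: "nat \<Rightarrow> (nat \<Rightarrow> real ^ 'd) \<Rightarrow> real" where
  "extent M \<omega> = (MAX l. (MAX i\<in>{1..M}. \<omega> i $ l) - (MIN i\<in>{1..M}. \<omega> i $ l))"

definition normalized_samples :: "nat \<Rightarrow> (nat \<Rightarrow> real ^ 'd) \<Rightarrow> nat \<Rightarrow> real ^ 'd" where
  "normalized_samples M \<omega> i = \<omega> i /\<^sub>R extent M \<omega>"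

definition normalized_map ::
    "nat \<Rightarrow> (nat \<Rightarrow> real ^ 'd) \<Rightarrow> (real ^ 'n \<Rightarrow> real ^ 'd) \<Rightarrow> real ^ 'n \<Rightarrow> real ^ 'd" where
  "normalized_map M \<omega> g y = g y /\<^sub>R extent M \<omega>"

definition kernel :: "real \<Rightarrow> real ^ 'd \<Rightarrow> real ^ 'd \<Rightarrow> real" where
  "kernel h u v = exp (- (norm (u - v))\<^sup>2 / h)"

text \<open>
  The objective as a function of the normalized visited points \<open>u\<close>, for normalized samples \<open>w\<close>.
\<close>

definition point_objective ::
    "real \<Rightarrow> nat \<Rightarrow> nat \<Rightarrow> (nat \<Rightarrow> real ^ 'd) \<Rightarrow> (nat \<Rightarrow> real ^ 'd) \<Rightarrow> real" where
  "point_objective h T M w u =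
     ln (\<Sum>t<T. \<Sum>t'<T. kernel h (u t) (u t'))
     - 2 * ln (\<Sum>t<T. \<Sum>i=1..M. kernel h (u t) (w i))"

definition log_surrogate ::
    "real \<Rightarrow> nat \<Rightarrow> nat \<Rightarrow> (nat \<Rightarrow> real ^ 'd) \<Rightarrow> (real ^ 'n \<Rightarrow> real ^ 'd) \<Rightarrow> (nat \<Rightarrow> real ^ 'n) \<Rightarrow> real"
  where
  "log_surrogate h T M \<omega> g x =
     point_objective h T M (normalized_samples M \<omega>) (\<lambda>t. normalized_map M \<omega> g (x t))"

text \<open>
  Partial gradients are relations: \<open>D\<close> is a gradient of the objective in its \<open>t\<close>-th argument, the
  other arguments being held fixed. The state gradient is taken within the state space \<open>X\<close>, which
  need not be open; it is then unique wherever derivatives within \<open>X\<close> are, in particular at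
  interior points.
\<close>

definition has_point_gradient ::
    "real \<Rightarrow> nat \<Rightarrow> nat \<Rightarrow> (nat \<Rightarrow> real ^ 'd) \<Rightarrow> (real ^ 'n \<Rightarrow> real ^ 'd) \<Rightarrow> (nat \<Rightarrow> real ^ 'n)
      \<Rightarrow> nat \<Rightarrow> real ^ 'd \<Rightarrow> bool" where
  "has_point_gradient h T M \<omega> g x t D \<longleftrightarrow>
     GDERIV (\<lambda>u. point_objective h T M (normalized_samples M \<omega>)
                   ((\<lambda>r. normalized_map M \<omega> g (x r))(t := u)))
            (normalized_map M \<omega> g (x t)) :> D"

definition has_state_gradient ::
    "(real ^ 'n) set \<Rightarrow> real \<Rightarrow> nat \<Rightarrow> nat \<Rightarrow> (nat \<Rightarrow> real ^ 'd) \<Rightarrow> (real ^ 'n \<Rightarrow> real ^ 'd)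
      \<Rightarrow> (nat \<Rightarrow> real ^ 'n) \<Rightarrow> nat \<Rightarrow> real ^ 'n \<Rightarrow> bool" where
  "has_state_gradient X h T M \<omega> g x t D \<longleftrightarrow>
     ((\<lambda>y. log_surrogate h T M \<omega> g (x(t := y))) has_derivative (\<lambda>v. v \<bullet> D)) (at (x t) within X)"

end

theory Submission
  imports Defs
begin

text \<open>The extent is homogeneous of degree one (\<open>extent_scaleR\<close>), so scaling the
  samples and the map by s > 0 cancels in the quotients that define the normalized samples and the
  normalized map. The objective sees the physical data only through these two, so it is the same
  function before and after rescaling, and every gradient of one is a gradient of the other. As
  gradients are relations here, this equivalence would hold vacuously if none existed. Existence
  comes from smoothness of the kernel and positivity of the kernel sums inside the logarithms
  (\<open>differentiable_point_objective\<close>), together with the representation of a linear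
  functional by a vector (\<open>differentiable_imp_gradient\<close>).\<close>

text \<open>Multiplication by a nonnegative s is monotone, so it commutes with maxima and minima of
  finite nonempty sets; M \<ge> 1 makes the sets of sample coordinates nonempty.\<close>

lemma extent_scaleR:
  fixes \<omega> :: "nat \<Rightarrow> real ^ 'd"
  assumes "M \<ge> 1" and "s \<ge> 0"
  shows "extent M (\<lambda>i. s *\<^sub>R \<omega> i) = s * extent M \<omega>"
proof -
  have mono: "mono ((*) s)"
    using assms(2) by (simp add: monoI mult_left_mono)
  have Max: "(MAX i\<in>{1..M}. s * \<omega> i $ l) = s * (MAX i\<in>{1..M}. \<omega> i $ l)" for l
    using mono_Max_commute[OF mono, of "(\<lambda>i. \<omega> i $ l) ` {1..M}"] assms(1)
    by (simp add: image_image)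
  have Min: "(MIN i\<in>{1..M}. s * \<omega> i $ l) = s * (MIN i\<in>{1..M}. \<omega> i $ l)" for l
    using mono_Min_commute[OF mono, of "(\<lambda>i. \<omega> i $ l) ` {1..M}"] assms(1)
    by (simp add: image_image)
  show ?thesis
    unfolding extent_def vector_scaleR_component real_scaleR_def Max Min
    using mono_Max_commute[OF mono,
        of "range (\<lambda>l. (MAX i\<in>{1..M}. \<omega> i $ l) - (MIN i\<in>{1..M}. \<omega> i $ l))"]
    by (simp add: image_image right_diff_distrib)
qed

lemma normalized_samples_scaleR:
  assumes "M \<ge> 1" and "s > 0"
  shows "normalized_samples M (\<lambda>i. s *\<^sub>R \<omega> i) = normalized_samples M \<omega>"
  using assms by (simp add: fun_eq_iff normalized_samples_def extent_scaleR)

lemma normalized_map_scaleR: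
  assumes "M \<ge> 1" and "s > 0"
  shows "normalized_map M (\<lambda>i. s *\<^sub>R \<omega> i) (\<lambda>y. s *\<^sub>R g y) = normalized_map M \<omega> g"
  using assms by (simp add: fun_eq_iff normalized_map_def extent_scaleR)

lemma differentiable_kernel:
  assumes "f differentiable (at y within S)" and "g differentiable (at y within S)"
  shows "(\<lambda>z. kernel h (f z) (g z)) differentiable (at y within S)"
proof -
  obtain f' g' where [derivative_intros]:
    "(f has_derivative f') (at y within S)" "(g has_derivative g') (at y within S)"
    using assms unfolding differentiable_def by blast
  show ?thesis
    \<comment> \<open>The squared norm is written as an inner product because the norm itself is not
      differentiable at 0, which occurs in the terms with t = t'.\<close>
    unfolding kernel_def power2_norm_eq_inner divide_inverse differentiable_def
    by (rule exI) (rule derivative_intros)+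
qed

lemma differentiable_ln:
  fixes f :: "'a::real_normed_vector \<Rightarrow> real"
  assumes "f differentiable (at y within S)" and "f y > 0"
  shows "(\<lambda>z. ln (f z)) differentiable (at y within S)"
  using assms has_derivative_ln unfolding differentiable_def by blast

lemma differentiable_point_objective:
  assumes diff: "\<And>r. r < T \<Longrightarrow> u r differentiable (at y within S)"
    and "T \<ge> 1" and "M \<ge> 1"
  shows "(\<lambda>z. point_objective h T M w (\<lambda>r. u r z)) differentiable (at y within S)"
proof -
  have pos: "kernel h a b > 0" for a b :: "real ^ 'd"
    by (simp add: kernel_def)
  \<comment> \<open>Both double sums are nonempty and have positive terms, so \<open>ln\<close> is
    only differentiated at positive arguments.\<close>
  have "(\<Sum>r<T. \<Sum>r'<T. kernel h (u r y) (u r' y)) > 0"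
    and "(\<Sum>r<T. \<Sum>i=1..M. kernel h (u r y) (w i)) > 0"
    using assms(2,3) by (auto intro!: sum_pos pos simp: lessThan_empty_iff)
  then show ?thesis
    unfolding point_objective_def
    by (intro differentiable_diff differentiable_mult differentiable_const differentiable_ln
        differentiable_sum finite_lessThan finite_atLeastAtMost ballI
        differentiable_kernel) (auto intro: diff)
qed

text \<open>Riesz representation: the gradient is the adjoint of the derivative applied to
  1.\<close>

lemma differentiable_imp_gradient:
  fixes f :: "'a::euclidean_space \<Rightarrow> real"
  assumes "f differentiable F"
  shows "\<exists>D. (f has_derivative (\<lambda>v. v \<bullet> D)) F"
proof -
  obtain f' where f': "(f has_derivative f') F"
    using assms unfolding differentiable_def by blast
  have "f' v = v \<bullet> adjoint f' 1" for v
    using adjoint_works[OF has_derivative_linear[OF f'], of v 1] by simp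
  then have "f' = (\<lambda>v. v \<bullet> adjoint f' 1)"
    by (rule ext)
  with f' show ?thesis
    by metis
qed

lemma ex_point_gradient:
  assumes "M \<ge> 1" and "t < T"
  shows "\<exists>D. has_point_gradient h T M \<omega> g x t D"
proof -
  define p where "p = (\<lambda>r. normalized_map M \<omega> g (x r))"
  \<comment> \<open>As a function of the moving point, component r is the identity if r = t and
    constant otherwise.\<close>
  have "(\<lambda>v. (p(t := v)) r) differentiable (at (p t))" for r
    by (cases "r = t") auto
  then have "(\<lambda>v. point_objective h T M (normalized_samples M \<omega>) (\<lambda>r. (p(t := v)) r))
      differentiable (at (p t))"
    using assms by (intro differentiable_point_objective) auto
  then show ?thesis
    unfolding has_point_gradient_def gderiv_def p_def
    by (intro differentiable_imp_gradient) (simp add: fun_upd_def)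
qed

lemma ex_state_gradient:
  assumes "g differentiable (at (x t) within X)" and "M \<ge> 1" and "t < T"
  shows "\<exists>D. has_state_gradient X h T M \<omega> g x t D"
proof -
  have "(\<lambda>y. normalized_map M \<omega> g ((x(t := y)) r)) differentiable (at (x t) within X)" for r
    using assms(1) by (cases "r = t") (auto simp: normalized_map_def)
  then show ?thesis
    unfolding has_state_gradient_def log_surrogate_def
    using assms by (intro differentiable_imp_gradient differentiable_point_objective) auto
qed

theorem proposition5:
  fixes X :: "(real ^ 'n) set"
    and g :: "real ^ 'n \<Rightarrow> real ^ 'd"
    and \<omega> :: "nat \<Rightarrow> real ^ 'd"
    and M T :: nat
    and h s :: real
    and x :: "nat \<Rightarrow> real ^ 'n"
  assumes "g differentiable_on X"
    and "M \<ge> 1"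
    and "extent M \<omega> > 0"
    and "h > 0"
    and "s > 0"
    and "\<forall>t<T. x t \<in> X"
  shows "let \<omega>' = (\<lambda>i. s *\<^sub>R \<omega> i); g' = (\<lambda>y. s *\<^sub>R g y) in
    log_surrogate h T M \<omega>' g' x = log_surrogate h T M \<omega> g x \<and>
    (\<forall>t<T. (\<exists>D. has_point_gradient h T M \<omega> g x t D) \<and>
      (\<forall>D. has_point_gradient h T M \<omega>' g' x t D \<longleftrightarrow> has_point_gradient h T M \<omega> g x t D)) \<and>
    (\<forall>t<T. (\<exists>D. has_state_gradient X h T M \<omega> g x t D) \<and>
      (\<forall>D. has_state_gradient X h T M \<omega>' g' x t D \<longleftrightarrow> has_state_gradient X h T M \<omega> g x t D))"
proof -
  \<comment> \<open>The equality is between functions of the whole trajectory, since a state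
    gradient also involves the values at trajectories near x.\<close>
  have scaled: "log_surrogate h T M (\<lambda>i. s *\<^sub>R \<omega> i) (\<lambda>y. s *\<^sub>R g y) = log_surrogate h T M \<omega> g"
    using assms
    by (simp add: fun_eq_iff log_surrogate_def normalized_samples_scaleR normalized_map_scaleR)
  have "has_point_gradient h T M (\<lambda>i. s *\<^sub>R \<omega> i) (\<lambda>y. s *\<^sub>R g y) x t D \<longleftrightarrow>
      has_point_gradient h T M \<omega> g x t D" for t D
    using assms
    by (simp add: has_point_gradient_def normalized_samples_scaleR normalized_map_scaleR)
  moreover have "has_state_gradient X h T M (\<lambda>i. s *\<^sub>R \<omega> i) (\<lambda>y. s *\<^sub>R g y) x t D \<longleftrightarrow>
      has_state_gradient X h T M \<omega> g x t D" for t D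
    by (simp add: has_state_gradient_def scaled)
  moreover have "\<exists>D. has_state_gradient X h T M \<omega> g x t D" if "t < T" for t
    using assms that by (intro ex_state_gradient) (auto simp: differentiable_on_def)
  ultimately show ?thesis
    using assms(2) by (simp add: scaled ex_point_gradient)
qed

end
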